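(* Let $P=([n],\preceq)$ be a poset, $w$ a weight on $\mathbb{F}_q$, $\pi(i)=k_i$ a label map with $N=k_1+\cdots+k_n$, and let $\mathbb{C}\subseteq\mathbb{F}_q^N$ be a code with $|\mathbb{C}|\ge2$ and minimum distance $d_{(P,w,\pi)}(\mathbb{C})$. Let $r=\big\lfloor\frac{d_{(P,w,\pi)}(\mathbb{C})-1}{M_w}\big\rfloor$. Then $$\max_{J\in\mathcal{I}^r}\Big\{\sum_{i\in J}k_i\Big\}\le N-\lceil\log_q|\mathbb{C}|\rceil.$$
   Context: A weight on $\mathbb{F}_q$ is a map $w:\mathbb{F}_q\to\mathbb{N}\cup\{0\}$ with $w(\alpha)=0$ iff $\alpha=0$, $w(-\alpha)=w(\alpha)$, $w(\alpha+\beta)\le w(\alpha)+w(\beta)$; $M_w=\max_\alpha w(\alpha)$; $\tilde w^k(v)=\max_s w(v_s)$ for $v\in\mathbb{F}_q^k$. Ideals of $P$ are down-closed subsets; $\langle A\rangle$ is the ideal generated by $A$; $\mathcal{I}^r$ is the set of ideals of $P$ of cardinality $r$. Writing $x=x_1\oplus\cdots\oplus x_n\in\mathbb{F}_q^{k_1}\oplus\cdots\oplus\mathbb{F}_q^{k_n}$, $supp_\pi(x)=\{i:x_i\ne0\}$, $I_x=\langle supp_\pi(x)\rangle$, $M_x$ the set of maximal elements of $I_x$, $w_{(P,w,\pi)}(x)=\sum_{i\in M_x}\tilde w^{k_i}(x_i)+|I_x\setminus M_x|\,M_w$, $d_{(P,w,\pi)}(x,y)=w_{(P,w,\pi)}(x-y)$,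 and $d_{(P,w,\pi)}(\mathbb{C})=\min\{d_{(P,w,\pi)}(c_1,c_2):c_1\ne c_2\in\mathbb{C}\}$. *)

theory Defs
  imports Complex_Main "HOL-Library.Cardinality" "Jordan_Normal_Form.Matrix"
begin

definition is_weight :: "('a::field \<Rightarrow> nat) \<Rightarrow> bool" where
  "is_weight w \<longleftrightarrow>
     (\<forall>a. w a = 0 \<longleftrightarrow> a = 0) \<and>
     (\<forall>a. w (- a) = w a) \<and>
     (\<forall>a b. w (a + b) \<le> w a + w b)"

definition max_weight :: "('a \<Rightarrow> nat) \<Rightarrow> nat" where
  "max_weight w = Max (range w)"

text \<open>Meaningful for vectors of positive dimension only.\<close>

definition vec_weight :: "('a \<Rightarrow> nat) \<Rightarrow> 'a vec \<Rightarrow> nat" where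
  "vec_weight w v = Max ((\<lambda>s. w (v $ s)) ` {..<dim_vec v})"

text \<open>A poset on \<open>[n] = {1..n}\<close> is a relation \<open>P\<close> with \<open>partial_order_on {1..n} P\<close>, where
  \<open>(i, j) \<in> P\<close> means that \<open>i\<close> is below or equal to \<open>j\<close>.\<close>

definition poset_ideal :: "nat \<Rightarrow> nat rel \<Rightarrow> nat set \<Rightarrow> bool" where
  "poset_ideal n P I \<longleftrightarrow> I \<subseteq> {1..n} \<and> (\<forall>j\<in>I. \<forall>i. (i, j) \<in> P \<longrightarrow> i \<in> I)"

definition ideals_of_card :: "nat \<Rightarrow> nat rel \<Rightarrow> nat \<Rightarrow> nat set set" where
  "ideals_of_card n P r = {I. poset_ideal n P I \<and> card I = r}"

definition maximal_elements :: "nat rel \<Rightarrow> nat set \<Rightarrow> nat set" where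
  "maximal_elements P I = {i \<in> I. \<forall>j\<in>I. (i, j) \<in> P \<longrightarrow> j = i}"

text \<open>Blocks are numbered from 1, but the entries of a vector from 0: block \<open>i\<close> of
  a vector of dimension \<open>k 1 + \<dots> + k n\<close> starts after the first \<open>i - 1\<close> blocks.\<close>

definition block :: "(nat \<Rightarrow> nat) \<Rightarrow> 'a vec \<Rightarrow> nat \<Rightarrow> 'a vec" where
  "block k x i = vec (k i) (\<lambda>s. x $ ((\<Sum>j\<in>{1..<i}. k j) + s))"

definition block_support :: "nat \<Rightarrow> (nat \<Rightarrow> nat) \<Rightarrow> 'a::zero vec \<Rightarrow> nat set" where
  "block_support n k x = {i \<in> {1..n}. block k x i \<noteq> 0\<^sub>v (k i)}"

definition support_ideal :: "nat \<Rightarrow> nat rel \<Rightarrow> (nat \<Rightarrow> nat) \<Rightarrow> 'a::zero vec \<Rightarrow> nat set" where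
  "support_ideal n P k x = poset_ideal n P hull block_support n k x"

definition block_weight ::
  "nat \<Rightarrow> nat rel \<Rightarrow> ('a::zero \<Rightarrow> nat) \<Rightarrow> (nat \<Rightarrow> nat) \<Rightarrow> 'a vec \<Rightarrow> nat" where
  "block_weight n P w k x =
     (let I = support_ideal n P k x; M = maximal_elements P I
      in (\<Sum>i\<in>M. vec_weight w (block k x i)) + card (I - M) * max_weight w)"

definition block_dist ::
  "nat \<Rightarrow> nat rel \<Rightarrow> ('a::field \<Rightarrow> nat) \<Rightarrow> (nat \<Rightarrow> nat) \<Rightarrow> 'a vec \<Rightarrow> 'a vec \<Rightarrow> nat" where
  "block_dist n P w k x y = block_weight n P w k (x - y)"

definition min_dist ::
  "nat \<Rightarrow> nat rel \<Rightarrow> ('a::field \<Rightarrow> nat) \<Rightarrow> (nat \<Rightarrow> nat) \<Rightarrow> 'a vec set \<Rightarrow> nat" where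
  "min_dist n P w k C =
     Min {block_dist n P w k x y | x y. x \<in> C \<and> y \<in> C \<and> x \<noteq> y}"

end

theory Submission
  imports Defs
begin

text \<open>Two distinct codewords that agree on all blocks outside an ideal \<open>J\<close> of cardinality \<open>r\<close>
  differ by a vector whose support ideal lies in \<open>J\<close>, so their distance is at most \<open>r M\<^sub>w\<close>, which is
  smaller than the minimum distance. Hence puncturing the code on \<open>J\<close> is injective, and the number of
  codewords is at most \<open>q\<close> to the number of remaining coordinates. The minimum distance is at
  most \<open>n M\<^sub>w\<close>, so \<open>r \<le> n\<close> and ideals of cardinality \<open>r\<close> exist.\<close>

text \<open>Induction on the number of blocks: a position beyond the first \<open>n\<close> blocks
  must lie in the last one. This is what lets a vector be recovered from its blocks.\<close>

lemma sum_less_block_decomp: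
  fixes k :: "nat \<Rightarrow> nat"
  assumes "p < (\<Sum>i\<in>{1..n}. k i)"
  obtains i s where "i \<in> {1..n}" "s < k i" "p = (\<Sum>j\<in>{1..<i}. k j) + s"
  using assms
proof (induction n arbitrary: thesis)
  case 0
  then show ?case by simp
next
  case (Suc n)
  show ?case
  proof (cases "p < (\<Sum>i\<in>{1..n}. k i)")
    case True
    then obtain i s where "i \<in> {1..n}" "s < k i" "p = (\<Sum>j\<in>{1..<i}. k j) + s"
      using Suc.IH by blast
    then show ?thesis by (intro Suc.prems(1)[of i s]) auto
  next
    case False
    have "{1..<Suc n} = {1..n}" by auto
    then show ?thesis
      using Suc.prems(2) False
      by (intro Suc.prems(1)[of "Suc n" "p - (\<Sum>i\<in>{1..n}. k i)"]) auto
  qed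
qed

lemma block_offset_less:
  fixes k :: "nat \<Rightarrow> nat"
  assumes "i \<in> {1..n}" "s < k i"
  shows "(\<Sum>j\<in>{1..<i}. k j) + s < (\<Sum>j\<in>{1..n}. k j)"
proof -
  have "(\<Sum>j\<in>{1..<i}. k j) + s < (\<Sum>j\<in>insert i {1..<i}. k j)"
    using assms by simp
  also have "\<dots> \<le> (\<Sum>j\<in>{1..n}. k j)"
    using assms by (intro sum_mono2) auto
  finally show ?thesis .
qed

text \<open>Subtraction of vectors takes its dimension from the second argument, so only
  \<open>y\<close> has a dimension hypothesis; \<open>block_offset_less\<close> keeps the entries
  that are read within this dimension.\<close>

lemma block_minus:
  fixes x y :: "'a::group_add vec"
  assumes "dim_vec y = (\<Sum>j\<in>{1..n}. k j)" "i \<in> {1..n}"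
  shows "block k (x - y) i = block k x i - block k y i"
  using assms block_offset_less[of i n _ k] by (auto simp: block_def)

lemma block_support_subset: "block_support n k x \<subseteq> {1..n}"
  by (auto simp: block_support_def)

lemma block_support_minus_subset:
  fixes x y :: "'a::group_add vec"
  assumes "dim_vec y = (\<Sum>j\<in>{1..n}. k j)"
    and "\<And>i. i \<in> {1..n} - J \<Longrightarrow> block k x i = block k y i"
  shows "block_support n k (x - y) \<subseteq> J"
proof
  fix i assume i: "i \<in> block_support n k (x - y)"
  have "block k x i - block k x i = 0\<^sub>v (k i)"
    by (auto simp: block_def)
  with i assms show "i \<in> J"
    by (force simp: block_support_def block_minus)
qed

lemma eq_if_blocks_eq:
  assumes "x \<in> carrier_vec (\<Sum>j\<in>{1..n}. k j)" "y \<in> carrier_vec (\<Sum>j\<in>{1..n}. k j)"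
    and blocks: "\<And>i. i \<in> {1..n} \<Longrightarrow> block k x i = block k y i"
  shows "x = y"
proof (rule eq_vecI)
  show "dim_vec x = dim_vec y" using assms by simp
  fix p assume "p < dim_vec y"
  then have "p < (\<Sum>j\<in>{1..n}. k j)" using assms(2) by simp
  then obtain i s where i: "i \<in> {1..n}" "s < k i" "p = (\<Sum>j\<in>{1..<i}. k j) + s"
    by (rule sum_less_block_decomp)
  have "block k x i $ s = block k y i $ s" using blocks[OF i(1)] by simp
  then show "x $ p = y $ p" using i by (simp add: block_def)
qed

lemma weight_le_max_weight:
  fixes w :: "'a::finite \<Rightarrow> nat"
  shows "w a \<le> max_weight w"
  by (simp add: max_weight_def)

text \<open>The support ideal is contained in every ideal that contains the support. Each of its
  maximal elements contributes at most \<open>max_weight w\<close>, each other element exactly that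
  much.\<close>

lemma block_weight_le:
  fixes w :: "'a::{zero,finite} \<Rightarrow> nat"
  assumes J: "poset_ideal n P J" and supp: "block_support n k x \<subseteq> J"
    and k: "\<forall>i\<in>{1..n}. k i \<ge> 1"
  shows "block_weight n P w k x \<le> card J * max_weight w"
proof -
  define I where "I = support_ideal n P k x"
  define M where "M = maximal_elements P I"
  have IJ: "I \<subseteq> J"
    unfolding I_def support_ideal_def by (rule hull_minimal[OF supp]) (rule J)
  have Jn: "J \<subseteq> {1..n}" using J by (simp add: poset_ideal_def)
  have finJ: "finite J" using Jn finite_subset by blast
  then have finI: "finite I" using IJ finite_subset by blast
  have MI: "M \<subseteq> I" by (auto simp: M_def maximal_elements_def)
  have "vec_weight w (block k x i) \<le> max_weight w" if "i \<in> M" for i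
  proof -
    \<comment> \<open>Positive block length keeps the set under \<open>Max\<close> in
      \<open>vec_weight\<close> nonempty.\<close>
    have "k i \<ge> 1" using that MI IJ Jn k by blast
    then have "{..<k i} \<noteq> {}" by (auto simp: lessThan_empty_iff)
    then show ?thesis
      unfolding vec_weight_def
      by (subst Max_le_iff) (auto simp: block_def weight_le_max_weight)
  qed
  then have "(\<Sum>i\<in>M. vec_weight w (block k x i)) \<le> card M * max_weight w"
    using sum_bounded_above[of M _ "max_weight w"] by simp
  then have "block_weight n P w k x \<le> card M * max_weight w + card (I - M) * max_weight w"
    by (simp add: block_weight_def Let_def flip: I_def M_def)
  also have "\<dots> = card I * max_weight w"
    using card_Diff_subset[of M I] card_mono[OF finI MI] finite_subset[OF MI finI] MI
    by (simp flip: add_mult_distrib)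
  also have "\<dots> \<le> card J * max_weight w"
    by (intro mult_right_mono card_mono finJ IJ) simp
  finally show ?thesis .
qed

text \<open>An ideal other than the whole poset stays down-closed when a minimal element of its
  complement is added, so ideals grow one element at a time from the empty one.\<close>

lemma ex_poset_ideal_of_card:
  assumes P: "partial_order_on {1..n} P" and "r \<le> n"
  shows "ideals_of_card n P r \<noteq> {}"
  using \<open>r \<le> n\<close>
proof (induction r)
  case 0
  have "{} \<in> ideals_of_card n P 0" by (simp add: ideals_of_card_def poset_ideal_def)
  then show ?case by blast
next
  case (Suc r)
  have PD: "P \<subseteq> {1..n} \<times> {1..n}" and refl: "refl_on {1..n} P" and "trans P" "antisym P"
    using P by (auto simp: partial_order_on_def preorder_on_def)
  obtain I where I: "poset_ideal n P I" "card I = r"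
    using Suc by (auto simp: ideals_of_card_def)
  then have In: "I \<subseteq> {1..n}" by (simp add: poset_ideal_def)
  then have finI: "finite I" using finite_subset by blast
  have "I \<noteq> {1..n}" using I(2) Suc.prems by auto
  then obtain m0 where "m0 \<in> {1..n} - I" using In by blast
  \<comment> \<open>An element with the smallest principal ideal is minimal outside \<open>I\<close>.\<close>
  then obtain m where m: "m \<in> {1..n} - I"
    and least: "\<And>i. i \<in> {1..n} - I \<Longrightarrow> card (P\<inverse> `` {m}) \<le> card (P\<inverse> `` {i})"
    using ex_has_least_nat[of "\<lambda>i. i \<in> {1..n} - I" m0 "\<lambda>i. card (P\<inverse> `` {i})"] by blast
  have "i \<in> insert m I" if im: "(i, m) \<in> P" for i
  proof (rule ccontr)
    \<comment> \<open>Such an \<open>i\<close> would have a strictly smaller principal ideal than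
      \<open>m\<close>, since \<open>m\<close> itself is missing from it.\<close>
    assume i: "i \<notin> insert m I"
    have "(m, m) \<in> P" using refl m by (auto dest: refl_onD)
    moreover have "(m, i) \<notin> P" using \<open>antisym P\<close> im i by (auto dest: antisymD)
    moreover have "P\<inverse> `` {i} \<subseteq> P\<inverse> `` {m}" using \<open>trans P\<close> im by (auto dest: transD)
    ultimately have "P\<inverse> `` {i} \<subset> P\<inverse> `` {m}" by blast
    moreover have "finite (P\<inverse> `` {m})"
      by (rule finite_subset[of _ "{1..n}"]) (use PD in auto)
    ultimately have "card (P\<inverse> `` {i}) < card (P\<inverse> `` {m})" by (rule psubset_card_mono[rotated])
    moreover have "i \<in> {1..n} - I" using im PD i by auto
    ultimately show False using least by fastforce
  qed
  then have "poset_ideal n P (insert m I)"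
    using I(1) m by (auto simp: poset_ideal_def)
  moreover have "card (insert m I) = Suc r"
    using m I(2) finI by simp
  ultimately show ?case by (auto simp: ideals_of_card_def)
qed

text \<open>Reading off the entries in the blocks of \<open>S\<close> embeds \<open>C\<close> into
  the functions from a set of \<open>(\<Sum>i\<in>S. k i)\<close> positions to the field.\<close>

lemma card_le_if_punctured_inj:
  fixes C :: "'a::finite vec set"
  assumes inj: "\<And>x y. \<lbrakk>x \<in> C; y \<in> C; \<And>i. i \<in> S \<Longrightarrow> block k x i = block k y i\<rbrakk> \<Longrightarrow> x = y"
    and "finite S"
  shows "card C \<le> CARD('a) ^ (\<Sum>i\<in>S. k i)"
proof -
  define D where "D = Sigma S (\<lambda>i. {..<k i})"
  \<comment> \<open>\<open>restrict\<close> fixes the values outside \<open>D\<close>, so that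
    \<open>f\<close> maps into a finite extensional function space.\<close>
  define f where "f x = restrict (\<lambda>(i, s). block k x i $ s) D" for x :: "'a vec"
  have finD: "finite D" using \<open>finite S\<close> by (simp add: D_def)
  have "inj_on f C"
  proof (rule inj_onI)
    fix x y assume xy: "x \<in> C" "y \<in> C" "f x = f y"
    show "x = y"
    proof (rule inj[OF xy(1,2)])
      fix i assume i: "i \<in> S"
      have "block k x i $ s = block k y i $ s" if "s < k i" for s
        using fun_cong[OF xy(3), of "(i, s)"] i that by (simp add: f_def D_def)
      then show "block k x i = block k y i"
        by (intro eq_vecI) (auto simp: block_def)
    qed
  qed
  moreover have "f ` C \<subseteq> (\<Pi>\<^sub>E _\<in>D. UNIV)" by (auto simp: f_def)
  moreover have "finite (\<Pi>\<^sub>E _\<in>D. UNIV :: 'a set)" using finD by (simp add: finite_PiE)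
  ultimately have "card C \<le> card (\<Pi>\<^sub>E _\<in>D. UNIV :: 'a set)" by (rule card_inj_on_le)
  also have "\<dots> = CARD('a) ^ (\<Sum>i\<in>S. k i)"
    using finD \<open>finite S\<close> by (simp add: card_PiE) (simp add: D_def)
  finally show ?thesis .
qed

lemma min_dist_le:
  assumes "finite C" "x \<in> C" "y \<in> C" "x \<noteq> y"
  shows "min_dist n P w k C \<le> block_dist n P w k x y"
  unfolding min_dist_def
proof (rule Min_le)
  have "{block_dist n P w k x y | x y. x \<in> C \<and> y \<in> C \<and> x \<noteq> y}
      \<subseteq> (\<lambda>(x, y). block_dist n P w k x y) ` (C \<times> C)" by auto
  then show "finite {block_dist n P w k x y | x y. x \<in> C \<and> y \<in> C \<and> x \<noteq> y}"
    by (rule finite_subset) (simp add: assms(1))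
qed (use assms in blast)

theorem theorem4p1:
  fixes n N r :: nat
    and P :: "nat rel"
    and w :: "'a::{field,finite} \<Rightarrow> nat"
    and k :: "nat \<Rightarrow> nat"
    and C :: "'a vec set"
  assumes "partial_order_on {1..n} P"
    and "is_weight w"
    and "\<forall>i\<in>{1..n}. k i \<ge> 1"
    and "N = (\<Sum>i\<in>{1..n}. k i)"
    and "C \<subseteq> carrier_vec N"
    and "card C \<ge> 2"
    and "r = nat \<lfloor>(real (min_dist n P w k C) - 1) / real (max_weight w)\<rfloor>"
  shows "int (Max ((\<lambda>J. \<Sum>i\<in>J. k i) ` ideals_of_card n P r))
           \<le> int N - \<lceil>log (real CARD('a)) (real (card C))\<rceil>"
proof -
  define d where "d = min_dist n P w k C"
  define m where "m = max_weight w"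
  have "w 1 \<noteq> 0" using assms(2) by (simp add: is_weight_def)
  then have "m > 0" using weight_le_max_weight[of w 1] by (simp add: m_def)
  have finC: "finite C" using assms(6) by (metis card.infinite not_numeral_le_zero)
  \<comment> \<open>Instead of showing \<open>d > 0\<close>, the value 0 is treated apart: the
    quotient is then negative and \<open>nat\<close> sends its floor to 0.\<close>
  have r0: "r = 0" if "d = 0"
  proof -
    have "- 1 < 1 / real (max_weight w)" by (rule less_le_trans[of _ 0]) simp_all
    then show ?thesis using that assms(7) by (simp flip: d_def)
  qed
  \<comment> \<open>Here the quotient is nonnegative, so \<open>nat\<close> leaves its floor
    unchanged.\<close>
  have rm: "r * m < d" if "d > 0"
  proof -
    have "real r \<le> (real d - 1) / real m"
      using assms(7) that by (simp flip: d_def m_def)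
    then have "real r * real m \<le> real d - 1" using \<open>m > 0\<close> by (simp add: pos_le_divide_eq)
    then have "real (r * m) < real d" by simp
    then show ?thesis by linarith
  qed

  have full: "poset_ideal n P {1..n}"
    using assms(1) by (auto simp: poset_ideal_def partial_order_on_def preorder_on_def)
  obtain x y where "x \<in> C" "y \<in> C" "x \<noteq> y"
    using assms(6) by (metis card_le_Suc0_iff_eq finC not_less_eq_eq numeral_2_eq_2)
  then have "d \<le> block_weight n P w k (x - y)"
    using min_dist_le[OF finC] by (simp add: d_def block_dist_def)
  also have "\<dots> \<le> n * m"
    using block_weight_le[OF full _ assms(3), of "x - y" w, OF block_support_subset]
    by (simp add: m_def)
  finally have "d \<le> n * m" .
  then have "r \<le> n"
    using r0 rm by (cases "d = 0") (auto dest: less_le_trans)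

  have bound: "int (\<Sum>i\<in>J. k i) \<le> int N - \<lceil>log (real CARD('a)) (real (card C))\<rceil>"
    if "J \<in> ideals_of_card n P r" for J
  proof -
    have J: "poset_ideal n P J" "card J = r" "J \<subseteq> {1..n}"
      using that by (auto simp: ideals_of_card_def poset_ideal_def)
    have finJ: "finite J" using J(3) finite_subset by blast
    have "card C \<le> CARD('a) ^ (\<Sum>i\<in>{1..n} - J. k i)"
    proof (rule card_le_if_punctured_inj)
      fix x y assume x: "x \<in> C" and y: "y \<in> C"
        and eq: "\<And>i. i \<in> {1..n} - J \<Longrightarrow> block k x i = block k y i"
      have car: "x \<in> carrier_vec (\<Sum>i\<in>{1..n}. k i)" "y \<in> carrier_vec (\<Sum>i\<in>{1..n}. k i)"
        using x y assms(4,5) by auto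
      show "x = y"
      proof (cases "d = 0")
        case True
        \<comment> \<open>With \<open>J\<close> empty, \<open>eq\<close> already covers all blocks
          and no distance argument is needed.\<close>
        then have "J = {}" using r0 J(2) finJ by simp
        then show ?thesis using eq_if_blocks_eq[OF car] eq by simp
      next
        case False
        have "block_support n k (x - y) \<subseteq> J"
          using car(2) eq by (intro block_support_minus_subset) auto
        then have "block_dist n P w k x y \<le> r * m"
          using block_weight_le[OF J(1) _ assms(3), of "x - y" w] J(2)
          by (simp add: block_dist_def m_def)
        then have "block_dist n P w k x y < d" using rm False by linarith
        then show ?thesis using min_dist_le[OF finC x y, of n P w k] by (force simp: d_def)
      qed
    qed simp
    also have "(\<Sum>i\<in>{1..n} - J. k i) = N - (\<Sum>i\<in>J. k i)"
      using J(3) assms(4) by (simp add: sum_diff_nat finJ)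
    finally have C_le: "real (card C) \<le> real CARD('a) ^ (N - (\<Sum>i\<in>J. k i))"
      by (metis of_nat_le_iff of_nat_power)
    \<comment> \<open>The elements 0 and 1 differ, so the base exceeds 1 and the logarithm is
      increasing.\<close>
    have "CARD('a) \<ge> 2"
      using card_mono[of UNIV "{0, 1 :: 'a}"] by simp
    then have "log (real CARD('a)) (real (card C)) \<le> of_int (int (N - (\<Sum>i\<in>J. k i)))"
      using C_le assms(6) by (subst log_le_iff) (auto simp: powr_realpow)
    then have "\<lceil>log (real CARD('a)) (real (card C))\<rceil> \<le> int (N - (\<Sum>i\<in>J. k i))"
      by (rule ceiling_le)
    \<comment> \<open>This makes the truncated subtraction in the exponent agree with the integer
      one in the goal.\<close>
    moreover have "(\<Sum>i\<in>J. k i) \<le> N"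
      unfolding assms(4) using J(3) by (intro sum_mono2) auto
    ultimately show ?thesis by linarith
  qed

  \<comment> \<open>The maximum is attained by some ideal, since the set of candidates is finite and
    nonempty; \<open>bound\<close> then applies to that ideal.\<close>
  have "ideals_of_card n P r \<subseteq> Pow {1..n}"
    by (auto simp: ideals_of_card_def poset_ideal_def)
  then have "finite (ideals_of_card n P r)" by (rule finite_subset) simp
  then have "Max ((\<lambda>J. \<Sum>i\<in>J. k i) ` ideals_of_card n P r) \<in> (\<lambda>J. \<Sum>i\<in>J. k i) ` ideals_of_card n P r"
    using ex_poset_ideal_of_card[OF assms(1) \<open>r \<le> n\<close>] by (intro Max_in) auto
  then show ?thesis using bound by auto
qed

end
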